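(* For every $n\ge 4$ there exists an origin-symmetric convex body $K$ in $\mathbb{R}^n$ such that the space $(\mathbb{R}^n,\|\cdot\|_K)$ does not embed in $L_0$.
   Context: A convex body is a compact convex set with nonempty interior; $\|x\|_K=\min\{a\ge 0: x\in aK\}$ is the Minkowski functional of $K$. The space $(\mathbb{R}^n,\|\cdot\|_K)$ embeds in $L_0$ if there exist a finite Borel (non-negative) measure $\mu$ on $S^{n-1}$ and a constant $C\in\mathbb{R}$ such that for every $x\in\mathbb{R}^n$, $\ln\|x\|_K=\int_{S^{n-1}}\ln|(x,\xi)|\,d\mu(\xi)+C$. *)

theory Defs
  imports "HOL-Analysis.Analysis"
begin

definition convex_body :: "(real ^ 'n) set \<Rightarrow> bool" where
  "convex_body K \<longleftrightarrow> compact K \<and> convex K \<and> interior K \<noteq> {}"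

definition origin_symmetric :: "(real ^ 'n) set \<Rightarrow> bool" where
  "origin_symmetric K \<longleftrightarrow> uminus ` K = K"

(* The minimum over a \<ge> 0 with x \<in> aK, rendered by LEAST; it is attained for every x
   whenever K is an origin-symmetric convex body. *)
definition minkowski_functional :: "(real ^ 'n) set \<Rightarrow> real ^ 'n \<Rightarrow> real" where
  "minkowski_functional K x = (LEAST a. 0 \<le> a \<and> x \<in> (\<lambda>y. a *\<^sub>R y) ` K)"

(* The identity ln N(x) = \<integral> ln |(x,\<xi>)| d\<mu>(\<xi>) + C is meant with ln 0 = -\<infinity>, while the library
   has ln 0 = 0.
   For x \<noteq> 0, the left-hand side is finite and the integrand is bounded above by ln (norm x),
   so the identity between extended reals says exactly that the integrand is \<mu>-almost
   everywhere finite, that it is integrable, and that the real identity holds.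
   For x = 0 both sides are -\<infinity> as soon as \<mu> \<noteq> 0, and \<mu> \<noteq> 0 follows from the cases x \<noteq> 0
   because N is homogeneous; hence x = 0 is left out. *)
definition embeds_in_L0 :: "(real ^ 'n \<Rightarrow> real) \<Rightarrow> bool" where
  "embeds_in_L0 N \<longleftrightarrow>
     (\<exists>(\<mu> :: (real ^ 'n) measure) (C :: real).
        sets \<mu> = sets (restrict_space borel (sphere 0 1)) \<and>
        finite_measure \<mu> \<and>
        (\<forall>x. x \<noteq> 0 \<longrightarrow>
           (AE \<xi> in \<mu>. x \<bullet> \<xi> \<noteq> 0) \<and>
           integrable \<mu> (\<lambda>\<xi>. ln \<bar>x \<bullet> \<xi>\<bar>) \<and>
           ln (N x) = (\<integral>\<xi>. ln \<bar>x \<bullet> \<xi>\<bar> \<partial>\<mu>) + C))"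

end

(* The body is the cube, whose norm is the sup norm. Fix a coordinate k and let X_t be a
   random vector with independent centred Gaussian coordinates, of standard deviation t at k
   and 1 elsewhere. For a unit vector xi the variable (X_t, xi) is centred Gaussian, so scaling
   gives E ln |(X_t, xi)| = ln (|xi|^2 - (1 - t^2) xi_k^2) / 2 + const. Averaging the
   representation of ln ||x|| over X_s and over X_(s/2) and subtracting, the right-hand side
   changes by at least a multiple of s^2 times the integral of xi_k^2. The left-hand side
   changes only if s |Z_k| exceeds all other |Z_i|, and since there are at least three of these
   it changes by O(s^(5/2)). So xi_k = 0 almost everywhere, while the case x = e_k says
   xi_k ~= 0 almost everywhere. Hence the measure vanishes and ln ||x|| is constant, which is
   absurd. *)
theory Submission
  imports Defs "HOL-Probability.Probability"
begin

subsection \<open>Gaussian averages of logarithms\<close>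

definition gauss :: "real measure" where
  "gauss = density lborel (\<lambda>u. ennreal (std_normal_density u))"

lemma sets_gauss [simp, measurable_cong]: "sets gauss = sets borel"
  and space_gauss [simp]: "space gauss = UNIV"
  by (simp_all add: gauss_def)

lemma prob_space_gauss: "prob_space gauss"
  unfolding gauss_def by (rule prob_space_normal_density) simp

lemma integrable_gauss_iff:
  fixes f :: "real \<Rightarrow> real"
  assumes "f \<in> borel_measurable borel"
  shows "integrable gauss f \<longleftrightarrow> integrable lborel (\<lambda>u. std_normal_density u * f u)"
  unfolding gauss_def using assms by (intro integrable_real_density) (auto simp: normal_density_nonneg)

text \<open>Near 0 the density is at most 1 and |u|^(-p) is integrable because p < 1. For |u| > 1
  the power is at most 1, so the density itself dominates.\<close>

lemma integrable_gauss_powr: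
  assumes "0 \<le> p" "p < 1"
  shows "integrable gauss (\<lambda>u. \<bar>u\<bar> powr (-p))"
proof -
  \<comment> \<open>\<open>f\<close> dominates the singular part on [0, 1]; its reflection
    \<open>f (- u)\<close> does so on [-1, 0].\<close>
  define f :: "real \<Rightarrow> real" where "f u = indicator {0..1} u *\<^sub>R u powr (-p)" for u
  have meas: "f \<in> borel_measurable borel" unfolding f_def by measurable
  have "(\<lambda>u::real. u powr (-p)) absolutely_integrable_on {0..1}"
    using integrable_on_powr_from_0[of "-p" 1] assms by (intro nonnegative_absolutely_integrable_1) auto
  then have "integrable lebesgue f" unfolding set_integrable_def f_def .
  then have f: "integrable lborel f"
    using integrable_completion[of f lborel] meas by simp
  have f': "integrable lborel (\<lambda>u. f (- u))"
    using lborel_integrable_real_affine[OF f, of "-1" 0] by simp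
  have "integrable lborel (\<lambda>u. std_normal_density u * \<bar>u\<bar> powr (-p))"
  proof (rule Bochner_Integration.integrable_bound)
    \<comment> \<open>The factor |u|^0 = 1 presents the density as an absolute moment of order
      0.\<close>
    show "integrable lborel (\<lambda>u. f u + f (-u) + std_normal_density u * \<bar>u\<bar> ^ 0)"
      by (intro Bochner_Integration.integrable_add f f' integrable_std_normal_moment_abs)
    show "AE u in lborel. norm (std_normal_density u * \<bar>u\<bar> powr (-p))
        \<le> norm (f u + f (-u) + std_normal_density u * \<bar>u\<bar> ^ 0)"
    proof (rule AE_I2)
      fix u :: real
      have \<phi>: "std_normal_density u \<le> 1"
      proof -
        have "1 \<le> sqrt (2 * pi)" using pi_gt3 by simp
        then show ?thesis unfolding std_normal_density_def
          by (intro mult_le_one) (auto simp: divide_le_eq)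
      qed
      have nn: "0 \<le> f u" "0 \<le> f (-u)" "0 \<le> std_normal_density u" by (auto simp: f_def normal_density_nonneg)
      show "norm (std_normal_density u * \<bar>u\<bar> powr (-p)) \<le> norm (f u + f (-u) + std_normal_density u * \<bar>u\<bar> ^ 0)"
      proof (cases "\<bar>u\<bar> \<le> 1")
        case True
        have "\<bar>u\<bar> powr (-p) \<le> f u + f (-u)"
          using True by (cases "u \<ge> 0") (auto simp: f_def indicator_def abs_if)
        moreover have "std_normal_density u * \<bar>u\<bar> powr (-p) \<le> \<bar>u\<bar> powr (-p)"
          using \<phi> nn(3) by (intro mult_left_le_one_le) auto
        ultimately have "std_normal_density u * \<bar>u\<bar> powr (-p) \<le> f u + f (-u) + std_normal_density u"
          using nn(3) by linarith
        then show ?thesis using nn by (simp add: abs_mult)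
      next
        case False
        have "\<bar>u\<bar> powr (-p) \<le> \<bar>u\<bar> powr 0" using False assms by (intro powr_mono) auto
        then have "\<bar>u\<bar> powr (-p) \<le> 1" using False by (simp split: if_splits)
        then have "std_normal_density u * \<bar>u\<bar> powr (-p) \<le> std_normal_density u"
          using nn(3) by (intro mult_left_le) auto
        then show ?thesis using nn by (simp add: abs_mult)
      qed
    qed
  qed auto
  then show ?thesis by (subst integrable_gauss_iff) auto
qed

lemma integrable_gauss_moment: "integrable gauss (\<lambda>u. \<bar>u\<bar> ^ k)"
  by (subst integrable_gauss_iff) (auto intro: integrable_std_normal_moment_abs)

text \<open>The logarithmic pole at 0 is dominated by |u|^(-1/2) and the growth at infinity by |u|,
  both of which have a finite Gaussian mean.\<close>

lemma integrable_gauss_ln: "integrable gauss (\<lambda>u. ln \<bar>u\<bar>)"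
proof (rule Bochner_Integration.integrable_bound)
  show "integrable gauss (\<lambda>u. 2 * \<bar>u\<bar> powr (- (1/2)) + \<bar>u\<bar> ^ 1)"
    by (intro Bochner_Integration.integrable_add integrable_mult_right integrable_gauss_powr integrable_gauss_moment) auto
  show "AE u in gauss. norm (ln \<bar>u\<bar>) \<le> norm (2 * \<bar>u\<bar> powr (- (1/2)) + \<bar>u\<bar> ^ 1)"
  proof (rule AE_I2)
    fix u :: real
    show "norm (ln \<bar>u\<bar>) \<le> norm (2 * \<bar>u\<bar> powr (- (1/2)) + \<bar>u\<bar> ^ 1)"
    proof (cases "u = 0")
      case False
      \<comment> \<open>The bound ln t <= t - 1 at t = |u|^(-1/2) controls -ln |u| = 2 ln t; at t =
        |u| it controls ln |u|.\<close>
      have "ln (\<bar>u\<bar> powr (-(1/2))) \<le> \<bar>u\<bar> powr (-(1/2)) - 1" "ln \<bar>u\<bar> \<le> \<bar>u\<bar> - 1"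
        by (rule ln_le_minus_one; use False in simp)+
      then have "- ln \<bar>u\<bar> \<le> 2 * \<bar>u\<bar> powr (-(1/2))" "ln \<bar>u\<bar> \<le> \<bar>u\<bar>"
        using False by (auto simp: ln_powr)
      then show ?thesis by (simp add: abs_le_iff add_increasing add_increasing2)
    qed simp
  qed
qed auto

section \<open>Gaussian vectors and their linear forms\<close>

definition gauss_vec :: "('n::finite \<Rightarrow> real) measure" where
  "gauss_vec = Pi\<^sub>M UNIV (\<lambda>_. gauss)"

lemma sets_gauss_vec [measurable_cong]: "sets gauss_vec = sets (Pi\<^sub>M UNIV (\<lambda>_. borel))"
  unfolding gauss_vec_def by (intro sets_PiM_cong) auto

lemma prob_space_gauss_vec: "prob_space gauss_vec"
  unfolding gauss_vec_def by (intro prob_space_PiM prob_space_gauss)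

lemma distr_gauss_vec_component: "distr gauss_vec borel (\<lambda>z. z i) = gauss"
proof -
  have "distr gauss_vec borel (\<lambda>z. z i) = distr gauss_vec gauss (\<lambda>z. z i)"
    by (intro distr_cong) auto
  also have "\<dots> = gauss"
    unfolding gauss_vec_def
    by (intro distr_PiM_component prob_space_gauss) auto
  finally show ?thesis .
qed

text \<open>The joint law of the coordinates is \<open>gauss_vec\<close> itself, which is by
  construction the product of their individual laws.\<close>

lemma indep_vars_gauss_vec:
  "prob_space.indep_vars gauss_vec (\<lambda>_. borel) (\<lambda>i z. z i) (UNIV :: 'n::finite set)"
proof -
  interpret prob_space "gauss_vec :: ('n \<Rightarrow> real) measure" by (rule prob_space_gauss_vec)
  have "distr gauss_vec (Pi\<^sub>M UNIV (\<lambda>_. borel)) (\<lambda>z. \<lambda>i\<in>(UNIV :: 'n set). z i) = gauss_vec"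
    by (simp only: restrict_UNIV) (intro distr_id2 sets_gauss_vec[symmetric])
  moreover have "Pi\<^sub>M UNIV (\<lambda>i :: 'n. distr gauss_vec borel (\<lambda>z. z i)) = gauss_vec"
    by (simp only: distr_gauss_vec_component) (simp add: gauss_vec_def)
  ultimately show ?thesis
    by (subst indep_vars_iff_distr_eq_PiM') auto
qed

text \<open>Stability of the normal law: the independent terms \<open>c i * z i\<close> are centred
  normal, and their variances add up to 1.\<close>

lemma distributed_gauss_vec_sum:
  fixes c :: "'n::finite \<Rightarrow> real"
  assumes "(\<Sum>i\<in>UNIV. (c i)\<^sup>2) = 1"
  shows "distributed gauss_vec lborel (\<lambda>z. \<Sum>i\<in>UNIV. c i * z i) (\<lambda>u. ennreal (std_normal_density u))"
proof -
  interpret prob_space "gauss_vec :: ('n \<Rightarrow> real) measure" by (rule prob_space_gauss_vec)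
  \<comment> \<open>Terms with coefficient 0 are dropped, since a degenerate normal law has no
    density.\<close>
  define I where "I = {i. c i \<noteq> 0}"
  have comp: "distributed gauss_vec lborel (\<lambda>z. z i) (\<lambda>u. ennreal (std_normal_density u))" for i :: 'n
    unfolding distributed_def
    using distr_gauss_vec_component[of i] distr_cong[of gauss_vec gauss_vec lborel borel "\<lambda>z. z i" "\<lambda>z. z i"]
    by (auto simp: gauss_def)
  have "distributed gauss_vec lborel (\<lambda>z. \<Sum>i\<in>I. c i * z i)
      (\<lambda>u. ennreal (normal_density (\<Sum>i\<in>I. 0) (sqrt (\<Sum>i\<in>I. \<bar>c i\<bar>\<^sup>2)) u))"
  proof (rule sum_indep_normal)
    show "I \<noteq> {}"
    proof
      assume "I = {}"
      then have "c i = 0" for i by (auto simp: I_def)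
      then show False using assms by simp
    qed
    have "indep_vars (\<lambda>_. borel) (\<lambda>i z. c i * z i) UNIV"
      using indep_vars_compose2[OF indep_vars_gauss_vec, of "\<lambda>i u. c i * u" "\<lambda>_. borel"] by simp
    then show "indep_vars (\<lambda>_. borel) (\<lambda>i z. c i * z i) I" by (rule indep_vars_subset) auto
    show "distributed gauss_vec lborel (\<lambda>z. c i * z i) (\<lambda>u. ennreal (normal_density 0 \<bar>c i\<bar> u))" if "i \<in> I" for i
      using normal_density_affine[OF comp, of "c i" 0 i] that by (simp add: I_def)
  qed (auto simp: I_def)
  moreover have "(\<Sum>i\<in>I. \<bar>c i\<bar>\<^sup>2) = 1"
    using assms by (subst sum.mono_neutral_left[of UNIV]) (auto simp: I_def)
  moreover have "(\<Sum>i\<in>I. c i * z i) = (\<Sum>i\<in>UNIV. c i * z i)" for z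
    by (intro sum.mono_neutral_left) (auto simp: I_def)
  ultimately show ?thesis by simp
qed

text \<open>Division by the standard deviation \<sigma> makes the linear form a standard Gaussian X,
  so the logarithm splits as ln \<sigma> + ln |X|. The third claim supplies the hypothesis of
  Fubini's theorem, the fourth the almost sure non-vanishing of single coordinates.\<close>

lemma integral_gauss_vec_ln_inner:
  fixes c :: "'n::finite \<Rightarrow> real"
  assumes "0 < (\<Sum>i\<in>UNIV. (c i)\<^sup>2)"
  shows "integrable gauss_vec (\<lambda>z. ln \<bar>\<Sum>i\<in>UNIV. c i * z i\<bar>)"
    and "(\<integral>z. ln \<bar>\<Sum>i\<in>UNIV. c i * z i\<bar> \<partial>gauss_vec) = ln (\<Sum>i\<in>UNIV. (c i)\<^sup>2) / 2 + (\<integral>u. ln \<bar>u\<bar> \<partial>gauss)"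
    and "(\<integral>z. \<bar>ln \<bar>\<Sum>i\<in>UNIV. c i * z i\<bar>\<bar> \<partial>gauss_vec)
      \<le> \<bar>ln (\<Sum>i\<in>UNIV. (c i)\<^sup>2)\<bar> / 2 + (\<integral>u. \<bar>ln \<bar>u\<bar>\<bar> \<partial>gauss)"
    and "AE z in gauss_vec. (\<Sum>i\<in>UNIV. c i * z i) \<noteq> 0"
proof -
  interpret prob_space "gauss_vec :: ('n \<Rightarrow> real) measure" by (rule prob_space_gauss_vec)
  define \<sigma> where "\<sigma> = sqrt (\<Sum>i\<in>UNIV. (c i)\<^sup>2)"
  define X where "X z = (\<Sum>i\<in>UNIV. c i / \<sigma> * z i)" for z
  have \<sigma>: "\<sigma> > 0" "ln \<sigma> = ln (\<Sum>i\<in>UNIV. (c i)\<^sup>2) / 2"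
    using assms by (auto simp: \<sigma>_def ln_sqrt)
  have sum: "(\<Sum>i\<in>UNIV. c i * z i) = \<sigma> * X z" for z
    using \<sigma> by (simp add: X_def sum_distrib_left)
  have "(\<Sum>i\<in>UNIV. (c i / \<sigma>)\<^sup>2) = 1"
    using assms by (simp add: power_divide flip: sum_divide_distrib) (simp add: \<sigma>_def)
  then have D: "distributed gauss_vec lborel X (\<lambda>u. ennreal (std_normal_density u))"
    unfolding X_def[abs_def] by (rule distributed_gauss_vec_sum)
  have mX [measurable]: "X \<in> borel_measurable gauss_vec"
    using distributed_measurable[OF D] by simp
  have distr: "distr gauss_vec borel X = gauss"
    using distributed_distr_eq_density[OF D] unfolding gauss_def
    by (simp add: distr_cong[of gauss_vec gauss_vec lborel borel X X, symmetric])
  have "AE u in gauss. u \<noteq> 0"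
    unfolding gauss_def using AE_lborel_singleton[of "0::real"] by (subst AE_density) (auto elim: AE_mp)
  then have nz: "AE z in gauss_vec. X z \<noteq> 0"
    unfolding distr[symmetric] by (subst (asm) AE_distr_iff) auto
  then show "AE z in gauss_vec. (\<Sum>i\<in>UNIV. c i * z i) \<noteq> 0"
    unfolding sum using \<sigma> by auto
  \<comment> \<open>The splitting can fail where X vanishes, because ln 0 = 0; hence it is claimed
    only almost everywhere.\<close>
  have ln: "AE z in gauss_vec. ln \<bar>\<sigma> * X z\<bar> = ln \<sigma> + ln \<bar>X z\<bar>"
    using nz by eventually_elim (use \<sigma> in \<open>simp add: abs_mult ln_mult\<close>)
  have iX: "integrable gauss_vec (\<lambda>z. ln \<bar>X z\<bar>)"
    using integrable_gauss_ln unfolding distr[symmetric] by (subst (asm) integrable_distr_eq) auto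
  then have "integrable gauss_vec (\<lambda>z. ln \<sigma> + ln \<bar>X z\<bar>)" by simp
  then show "integrable gauss_vec (\<lambda>z. ln \<bar>\<Sum>i\<in>UNIV. c i * z i\<bar>)"
    unfolding sum using ln by (subst integrable_cong_AE[OF _ _ ln]) auto
  have "(\<integral>z. ln \<bar>\<sigma> * X z\<bar> \<partial>gauss_vec) = (\<integral>z. ln \<sigma> + ln \<bar>X z\<bar> \<partial>gauss_vec)"
    by (intro integral_cong_AE ln) auto
  also have "\<dots> = ln \<sigma> + (\<integral>z. ln \<bar>X z\<bar> \<partial>gauss_vec)" using iX by (simp add: prob_space)
  also have "(\<integral>z. ln \<bar>X z\<bar> \<partial>gauss_vec) = (\<integral>u. ln \<bar>u\<bar> \<partial>gauss)"
    unfolding distr[symmetric] by (subst integral_distr) auto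
  finally show "(\<integral>z. ln \<bar>\<Sum>i\<in>UNIV. c i * z i\<bar> \<partial>gauss_vec) = ln (\<Sum>i\<in>UNIV. (c i)\<^sup>2) / 2 + (\<integral>u. ln \<bar>u\<bar> \<partial>gauss)"
    unfolding sum \<sigma> .
  have "(\<integral>z. \<bar>ln \<bar>\<sigma> * X z\<bar>\<bar> \<partial>gauss_vec) = (\<integral>z. \<bar>ln \<sigma> + ln \<bar>X z\<bar>\<bar> \<partial>gauss_vec)"
    using ln by (intro integral_cong_AE) auto
  also have "\<dots> \<le> (\<integral>z. \<bar>ln \<sigma>\<bar> + \<bar>ln \<bar>X z\<bar>\<bar> \<partial>gauss_vec)"
    using iX by (intro integral_mono) auto
  also have "\<dots> = \<bar>ln \<sigma>\<bar> + (\<integral>z. \<bar>ln \<bar>X z\<bar>\<bar> \<partial>gauss_vec)" using iX by (simp add: prob_space)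
  also have "(\<integral>z. \<bar>ln \<bar>X z\<bar>\<bar> \<partial>gauss_vec) = (\<integral>u. \<bar>ln \<bar>u\<bar>\<bar> \<partial>gauss)"
    unfolding distr[symmetric] by (subst integral_distr) auto
  finally show "(\<integral>z. \<bar>ln \<bar>\<Sum>i\<in>UNIV. c i * z i\<bar>\<bar> \<partial>gauss_vec)
      \<le> \<bar>ln (\<Sum>i\<in>UNIV. (c i)\<^sup>2)\<bar> / 2 + (\<integral>u. \<bar>ln \<bar>u\<bar>\<bar> \<partial>gauss)"
    unfolding sum \<sigma> by simp
qed

subsection \<open>The cube\<close>

lemma infnorm_le_iff_cart:
  fixes x :: "real ^ 'n"
  shows "infnorm x \<le> a \<longleftrightarrow> (\<forall>i. \<bar>x $ i\<bar> \<le> a)"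
proof
  assume "\<forall>i. \<bar>x $ i\<bar> \<le> a"
  then show "infnorm x \<le> a" unfolding infnorm_cart by (intro cSup_least) auto
qed (meson component_le_infnorm_cart order_trans)

lemma minkowski_functional_cube:
  "minkowski_functional (cbox (-1) 1) = (infnorm :: real ^ 'n \<Rightarrow> real)"
proof
  fix x :: "real ^ 'n"
  show "minkowski_functional (cbox (-1) 1) x = infnorm x"
    unfolding minkowski_functional_def
  proof (rule Least_equality)
    show "0 \<le> infnorm x \<and> x \<in> (\<lambda>y. infnorm x *\<^sub>R y) ` cbox (-1) 1"
    \<comment> \<open>The witness in the cube is x divided by its sup norm, except at x = 0, where
      both the witness and the scale factor are 0.\<close>
    proof (cases "x = 0")
      case True
      then show ?thesis by (auto simp: infnorm_0 mem_box_cart intro!: image_eqI[of _ _ 0])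
    next
      case False
      then have pos: "infnorm x > 0" by (simp add: infnorm_pos_lt)
      have "(1 / infnorm x) *\<^sub>R x \<in> cbox (-1) 1"
        using component_le_infnorm_cart[of x] pos
        by (auto simp: mem_box_cart divide_simps abs_le_iff) (smt (verit))+
      then show ?thesis using pos by (intro conjI image_eqI[of _ _ "(1 / infnorm x) *\<^sub>R x"]) auto
    qed
    show "infnorm x \<le> a" if a: "0 \<le> a \<and> x \<in> (\<lambda>y. a *\<^sub>R y) ` cbox (-1) 1" for a
    proof -
      obtain y where y: "x = a *\<^sub>R y" "y \<in> cbox (-1) 1" using a by blast
      have "\<bar>x $ i\<bar> \<le> a" for i
        using y a by (auto simp: mem_box_cart abs_mult abs_le_iff intro!: mult_left_le)
      then show ?thesis by (simp add: infnorm_le_iff_cart)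
    qed
  qed
qed

lemma convex_body_cube: "convex_body (cbox (-1) (1 :: real ^ 'n))"
proof -
  have "(0 :: real ^ 'n) \<in> box (-1) 1" by (simp add: mem_box_cart)
  then show ?thesis by (auto simp: convex_body_def)
qed

lemma origin_symmetric_cube: "origin_symmetric (cbox (-1) (1 :: real ^ 'n))"
proof -
  have "- x \<in> cbox (-1) 1" if "x \<in> cbox (-1) 1" for x :: "real ^ 'n"
    using that by (auto simp: mem_box_cart)
  then show ?thesis unfolding origin_symmetric_def
    by (auto intro!: image_eqI[of x uminus "- x" for x])
qed

subsection \<open>Averaging the representation\<close>

text \<open>Samples of \<open>gauss_vec\<close> are functions, to which facts on product measures
  apply. This turns a sample into a vector whose independent centred coordinates have standard
  deviations |d i|.\<close>

definition gauss_scale :: "('n::finite \<Rightarrow> real) \<Rightarrow> ('n \<Rightarrow> real) \<Rightarrow> real ^ 'n" where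
  "gauss_scale d z = (\<chi> i. d i * z i)"

lemma space_sphere_measure:
  fixes \<mu> :: "(real ^ 'n) measure"
  assumes "sets \<mu> = sets (restrict_space borel (sphere 0 1))"
  shows "space \<mu> = sphere 0 1"
  using sets_eq_imp_space_eq[OF assms] by (simp add: space_restrict_space)

lemma borel_measurable_sphere_nth:
  fixes \<mu> :: "(real ^ 'n) measure"
  assumes "sets \<mu> = sets (restrict_space borel (sphere 0 1))"
  shows "(\<lambda>\<xi>. \<xi> $ i) \<in> borel_measurable \<mu>"
  unfolding measurable_cong_sets[OF assms refl]
  by (intro measurable_restrict_space1 borel_measurable_continuous_onI continuous_intros)

text \<open>Once the integrals are exchanged, the inner one is the Gaussian average for the linear
  form with coefficients \<open>d i * \<xi> $ i\<close>, whose variance is \<open>S \<xi>\<close>.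
  Positivity of every \<open>d i\<close> makes \<open>S\<close> positive on the sphere.\<close>

lemma gauss_average_ln_inner:
  fixes \<mu> :: "(real ^ 'n) measure" and d :: "'n \<Rightarrow> real"
  assumes sets: "sets \<mu> = sets (restrict_space borel (sphere 0 1))"
    and fin: "finite_measure \<mu>" and d: "\<And>i. d i > 0"
  defines "S \<equiv> (\<lambda>\<xi> :: real ^ 'n. \<Sum>i\<in>UNIV. (d i * \<xi> $ i)\<^sup>2)"
  shows "integrable gauss_vec (\<lambda>z. \<integral>\<xi>. ln \<bar>gauss_scale d z \<bullet> \<xi>\<bar> \<partial>\<mu>)"
    and "(\<integral>z. (\<integral>\<xi>. ln \<bar>gauss_scale d z \<bullet> \<xi>\<bar> \<partial>\<mu>) \<partial>gauss_vec)
        = (\<integral>\<xi>. ln (S \<xi>) / 2 \<partial>\<mu>) + (\<integral>u. ln \<bar>u\<bar> \<partial>gauss) * measure \<mu> (space \<mu>)"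
    and "integrable \<mu> (\<lambda>\<xi>. ln (S \<xi>))"
proof -
  interpret \<mu>: finite_measure \<mu> by (rule fin)
  interpret G: prob_space "gauss_vec :: ('n \<Rightarrow> real) measure" by (rule prob_space_gauss_vec)
  interpret P: pair_sigma_finite \<mu> "gauss_vec :: ('n \<Rightarrow> real) measure" ..
  note space = space_sphere_measure[OF sets] and nth [measurable] = borel_measurable_sphere_nth[OF sets]
  have S [measurable]: "S \<in> borel_measurable \<mu>" unfolding S_def by measurable
  have S_pos: "S \<xi> > 0" if "\<xi> \<in> sphere 0 1" for \<xi>
  proof -
    have "\<xi> \<noteq> 0" using that by auto
    then obtain i where "\<xi> $ i \<noteq> 0" by (auto simp: vec_eq_iff)
    then show ?thesis unfolding S_def using d[of i] by (intro sum_pos2[of _ i]) auto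
  qed
  \<comment> \<open>Compactness of the sphere gives a single bound \<open>B\<close> for |ln S|. The
    Gaussian averages of the absolute values are then uniformly bounded, hence integrable over the
    finite measure \<mu>.\<close>
  have "continuous_on (sphere 0 1) (\<lambda>\<xi>. ln (S \<xi>))"
  proof (intro continuous_on_ln ballI)
    show "continuous_on (sphere 0 1) S" unfolding S_def by (intro continuous_intros)
  qed (use S_pos in force)
  then have "bounded ((\<lambda>\<xi>. ln (S \<xi>)) ` sphere 0 1)"
    by (intro compact_imp_bounded compact_continuous_image compact_sphere)
  then obtain B where B: "\<And>\<xi>. \<xi> \<in> sphere 0 1 \<Longrightarrow> norm (ln (S \<xi>)) \<le> B"
    unfolding bounded_iff by blast
  show lnS: "integrable \<mu> (\<lambda>\<xi>. ln (S \<xi>))"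
    by (rule \<mu>.integrable_const_bound[of _ B]) (use B space in auto)
  define f where "f \<xi> z = ln \<bar>\<Sum>i\<in>UNIV. d i * \<xi> $ i * z i\<bar>" for \<xi> :: "real ^ 'n" and z
  have f: "ln \<bar>gauss_scale d z \<bullet> \<xi>\<bar> = f \<xi> z" for \<xi> z
    by (simp add: f_def gauss_scale_def inner_vec_def mult_ac)
  have meas [measurable]: "(\<lambda>(\<xi>, z). f \<xi> z) \<in> borel_measurable (\<mu> \<Otimes>\<^sub>M gauss_vec)"
    unfolding f_def by measurable
  have int: "integrable (\<mu> \<Otimes>\<^sub>M gauss_vec) (\<lambda>(\<xi>, z). f \<xi> z)"
  proof (rule P.Fubini_integrable[OF meas], unfold prod.case)
    show "integrable \<mu> (\<lambda>\<xi>. \<integral>z. norm (f \<xi> z) \<partial>gauss_vec)"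
    proof (rule \<mu>.integrable_const_bound[of _ "B / 2 + (\<integral>u. \<bar>ln \<bar>u\<bar>\<bar> \<partial>gauss)"])
      show "AE \<xi> in \<mu>. norm (\<integral>z. norm (f \<xi> z) \<partial>gauss_vec) \<le> B / 2 + (\<integral>u. \<bar>ln \<bar>u\<bar>\<bar> \<partial>gauss)"
      proof (rule AE_I2)
        fix \<xi> assume "\<xi> \<in> space \<mu>"
        then have \<xi>: "\<xi> \<in> sphere 0 1" by (simp add: space)
        have "norm (\<integral>z. norm (f \<xi> z) \<partial>gauss_vec) = (\<integral>z. \<bar>f \<xi> z\<bar> \<partial>gauss_vec)"
          by simp
        also have "\<dots> \<le> \<bar>ln (S \<xi>)\<bar> / 2 + (\<integral>u. \<bar>ln \<bar>u\<bar>\<bar> \<partial>gauss)"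
          unfolding f_def S_def by (rule integral_gauss_vec_ln_inner(3)) (use S_pos[OF \<xi>] in \<open>simp add: S_def\<close>)
        also have "\<dots> \<le> B / 2 + (\<integral>u. \<bar>ln \<bar>u\<bar>\<bar> \<partial>gauss)" using B[OF \<xi>] by simp
        finally show "norm (\<integral>z. norm (f \<xi> z) \<partial>gauss_vec) \<le> B / 2 + (\<integral>u. \<bar>ln \<bar>u\<bar>\<bar> \<partial>gauss)" .
      qed
    qed measurable
    show "AE \<xi> in \<mu>. integrable gauss_vec (f \<xi>)"
      unfolding f_def
      by (intro AE_I2 integral_gauss_vec_ln_inner(1)) (use S_pos space in \<open>auto simp: S_def\<close>)
  qed
  show "integrable gauss_vec (\<lambda>z. \<integral>\<xi>. ln \<bar>gauss_scale d z \<bullet> \<xi>\<bar> \<partial>\<mu>)"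
    unfolding f using P.integrable_snd[OF int] by simp
  have "(\<integral>z. (\<integral>\<xi>. f \<xi> z \<partial>\<mu>) \<partial>gauss_vec) = (\<integral>\<xi>. (\<integral>z. f \<xi> z \<partial>gauss_vec) \<partial>\<mu>)"
    by (rule P.Fubini_integral[OF int])
  also have "\<dots> = (\<integral>\<xi>. ln (S \<xi>) / 2 + (\<integral>u. ln \<bar>u\<bar> \<partial>gauss) \<partial>\<mu>)"
    unfolding f_def S_def
    by (intro Bochner_Integration.integral_cong refl integral_gauss_vec_ln_inner(2))
      (use S_pos space in \<open>auto simp: S_def\<close>)
  also have "\<dots> = (\<integral>\<xi>. ln (S \<xi>) / 2 \<partial>\<mu>) + (\<integral>u. ln \<bar>u\<bar> \<partial>gauss) * measure \<mu> (space \<mu>)"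
    using lnS by (subst Bochner_Integration.integral_add) auto
  finally show "(\<integral>z. (\<integral>\<xi>. ln \<bar>gauss_scale d z \<bullet> \<xi>\<bar> \<partial>\<mu>) \<partial>gauss_vec)
        = (\<integral>\<xi>. ln (S \<xi>) / 2 \<partial>\<mu>) + (\<integral>u. ln \<bar>u\<bar> \<partial>gauss) * measure \<mu> (space \<mu>)"
    unfolding f .
qed

section \<open>Comparison of the two sides for small scales\<close>

text \<open>The other \<^term>\<open>CARD('n) - 1\<close> coordinates share the exponent \<open>- 5/2\<close> equally. With at
  least three of them each exponent exceeds \<open>-1\<close>, which makes the product integrable, while
  \<open>5/2 > 2\<close> beats the quadratic growth on the other side.\<close>

definition gauss_weight :: "'n::finite \<Rightarrow> ('n \<Rightarrow> real) \<Rightarrow> real" where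
  "gauss_weight k z = (\<Prod>i\<in>UNIV. \<bar>z i\<bar> powr (if i = k then 5/2 else - (5/2) / real (CARD('n) - 1)))"

text \<open>On a product measure it suffices that each one-variable factor is integrable. The
  singular factors are |u|^(-p) with p = (5/2)/(n - 1) <= 5/6 < 1.\<close>

lemma integrable_gauss_weight:
  assumes "CARD('n::finite) \<ge> 4"
  shows "integrable gauss_vec (gauss_weight (k :: 'n))"
proof -
  interpret product_sigma_finite "\<lambda>_ :: 'n. gauss"
    unfolding product_sigma_finite_def
    using prob_space_gauss prob_space_imp_sigma_finite by blast
  have 1: "integrable gauss (\<lambda>u. \<bar>u\<bar> powr (5/2))"
  proof (rule Bochner_Integration.integrable_bound)
    show "integrable gauss (\<lambda>u. \<bar>u\<bar> ^ 0 + \<bar>u\<bar> ^ 3)"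
      by (intro Bochner_Integration.integrable_add integrable_gauss_moment)
    show "AE u in gauss. norm (\<bar>u\<bar> powr (5/2)) \<le> norm (\<bar>u\<bar> ^ 0 + \<bar>u\<bar> ^ 3)"
    proof (rule AE_I2)
      fix u :: real
      have "\<bar>u\<bar> powr (5/2) \<le> 1 + \<bar>u\<bar> ^ 3"
      proof (cases "\<bar>u\<bar> \<le> 1")
        case True
        then have "\<bar>u\<bar> powr (5/2) \<le> 1" by (intro powr_le1) auto
        then show ?thesis by (simp add: add_increasing2)
      next
        case False
        then have "\<bar>u\<bar> powr (5/2) \<le> \<bar>u\<bar> powr (real 3)" by (intro powr_mono) auto
        also have "\<dots> = \<bar>u\<bar> ^ 3" using False by (intro powr_realpow) auto
        finally show ?thesis by simp
      qed
      then show "norm (\<bar>u\<bar> powr (5/2)) \<le> norm (\<bar>u\<bar> ^ 0 + \<bar>u\<bar> ^ 3)" by simp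
    qed
  qed auto
  have 2: "integrable gauss (\<lambda>u. \<bar>u\<bar> powr (- (5/2) / real (CARD('n) - 1)))"
    using integrable_gauss_powr[of "(5/2) / real (CARD('n) - 1)"] assms by simp
  show ?thesis
    unfolding gauss_weight_def gauss_vec_def
    by (rule product_integrable_prod) (use 1 2 in auto)
qed

text \<open>The vectors differ only in coordinate k, so the first norm can exceed m only if w = s
  |z_k| does. In that case the gain is at most ln (w / m) <= (w / m)^(5/2), and m is at least every
  other |z_i|.\<close>

lemma ln_infnorm_diff_le:
  fixes z :: "'n::finite \<Rightarrow> real"
  assumes card: "CARD('n) \<ge> 4" and z: "\<And>i. z i \<noteq> 0" and s: "0 < s"
  shows "ln (infnorm (gauss_scale (\<lambda>i. if i = k then s else 1) z))
       - ln (infnorm (gauss_scale (\<lambda>i. if i = k then s / 2 else 1) z))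
      \<le> s powr (5/2) * gauss_weight k z"
proof -
  define x where "x = gauss_scale (\<lambda>i. if i = k then s else 1) z"
  define m where "m = infnorm (gauss_scale (\<lambda>i. if i = k then s / 2 else 1) z)"
  define w where "w = s * \<bar>z k\<bar>"
  have w: "w > 0" using z[of k] s by (simp add: w_def)
  have le_m: "\<bar>z i\<bar> \<le> m" if "i \<noteq> k" for i
    using component_le_infnorm_cart[of "gauss_scale (\<lambda>i. if i = k then s / 2 else 1) z" i] that
    by (simp add: m_def gauss_scale_def)
  \<comment> \<open>A coordinate other than k bounds m below by a positive number.\<close>
  have "UNIV \<noteq> {k}" using card by (metis One_nat_def card_1_singleton_iff numeral_le_one_iff semiring_norm(69))
  then obtain j where "j \<noteq> k" by auto
  then have m: "m > 0" using le_m[of j] z[of j] by simp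
  have x: "infnorm x > 0"
    using component_le_infnorm_cart[of x k] w s by (simp add: x_def gauss_scale_def w_def abs_mult)
  have x_le: "infnorm x \<le> max m w"
    unfolding infnorm_le_iff_cart using le_m s
    by (auto simp: x_def gauss_scale_def w_def abs_mult le_max_iff_disj)
  have nonneg: "0 \<le> s powr (5/2) * gauss_weight k z"
    by (simp add: gauss_weight_def prod_nonneg)
  have "ln (infnorm x) - ln m \<le> s powr (5/2) * gauss_weight k z"
  proof (cases "w \<le> m")
    case True
    then have "ln (infnorm x) \<le> ln m" using x x_le by simp
    then show ?thesis using nonneg by linarith
  next
    case False
    then have "ln (infnorm x) - ln m \<le> ln (w / m)" using x x_le m w by (simp add: ln_div)
    \<comment> \<open>As w / m > 1, raising it to the power 5/2 only enlarges the logarithm; ln t <=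
      t - 1 then removes the logarithm.\<close>
    also have "\<dots> \<le> ln ((w / m) powr (5/2))" using False m w by (simp add: ln_powr)
    also have "\<dots> \<le> (w / m) powr (5/2)"
      using ln_le_minus_one[of "(w / m) powr (5/2)"] m w by simp
    also have "\<dots> = w powr (5/2) * m powr - (5/2)"
      using m w by (simp add: powr_divide powr_minus divide_simps)
    \<comment> \<open>The exponent is shared equally among the n - 1 other coordinates, to match
      \<open>gauss_weight\<close>.\<close>
    also have "m powr - (5/2) = (\<Prod>i\<in>UNIV-{k}. m powr (- (5/2) / real (CARD('n) - 1)))"
    proof -
      have "- (5/2) = - (5/2) / N * N" if "N \<noteq> 0" for N :: real using that by simp
      then have "- (5/2) = - (5/2) / real (CARD('n) - 1) * real (CARD('n) - 1)"
        by this (use card in simp)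
      then have "m powr - (5/2) = (m powr (- (5/2) / real (CARD('n) - 1))) powr real (CARD('n) - 1)"
        by (simp only: powr_powr)
      also have "\<dots> = (m powr (- (5/2) / real (CARD('n) - 1))) ^ (CARD('n) - 1)"
        using m by (intro powr_realpow) simp
      finally show ?thesis by (simp add: card_Diff_singleton)
    qed
    \<comment> \<open>The exponent is negative, so replacing m by the smaller |z_i| does not
      decrease any factor.\<close>
    also have "\<dots> \<le> (\<Prod>i\<in>UNIV-{k}. \<bar>z i\<bar> powr (- (5/2) / real (CARD('n) - 1)))"
      using le_m z by (intro prod_mono conjI powr_mono2') auto
    also have "w powr (5/2) = s powr (5/2) * \<bar>z k\<bar> powr (5/2)"
      using s by (simp add: w_def powr_mult)
    also have "s powr (5/2) * \<bar>z k\<bar> powr (5/2) * (\<Prod>i\<in>UNIV-{k}. \<bar>z i\<bar> powr (- (5/2) / real (CARD('n) - 1)))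
        = s powr (5/2) * gauss_weight k z"
      unfolding gauss_weight_def by (subst prod.remove[of UNIV k]) auto
    finally show ?thesis by (simp add: mult_left_mono)
  qed
  then show ?thesis by (simp add: x_def m_def)
qed

text \<open>The two sums differ by y = (3/4) s^2 \<xi>_k^2, and the larger is at most 4 by the crude
  bounds P <= 1 and y <= 3. So the logarithms differ by at least y / 4, which explains 3/16.\<close>

lemma sphere_quadratic_ln_diff:
  fixes \<xi> :: "real ^ 'n"
  assumes "\<xi> \<in> sphere 0 1" "0 < s" "s \<le> 1"
  shows "3 / 16 * s\<^sup>2 * (\<xi> $ k)\<^sup>2
    \<le> ln (\<Sum>i\<in>UNIV. ((if i = k then s else 1) * \<xi> $ i)\<^sup>2)
     - ln (\<Sum>i\<in>UNIV. ((if i = k then s / 2 else 1) * \<xi> $ i)\<^sup>2)"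
proof -
  define b where "b = (\<xi> $ k)\<^sup>2"
  define y where "y = 3 / 4 * (s\<^sup>2 * b)"
  define a where "a = (\<Sum>i\<in>UNIV-{k}. (\<xi> $ i)\<^sup>2)"
  have sum: "(\<Sum>i\<in>UNIV. ((if i = k then r else 1) * \<xi> $ i)\<^sup>2) = r\<^sup>2 * b + a" for r
    unfolding a_def b_def by (subst sum.remove[of UNIV k]) (auto simp: power_mult_distrib)
  have nonneg: "a \<ge> 0" "b \<ge> 0" unfolding a_def b_def by (auto intro: sum_nonneg)
  have "(\<Sum>i\<in>UNIV. (\<xi> $ i)\<^sup>2) = 1"
    using assms(1) by (simp add: norm_vec_def L2_set_def)
  then have ab: "b + a = 1" using sum[of 1] by (simp cong: if_cong)
  have s: "0 < s\<^sup>2" "s\<^sup>2 \<le> 1" using assms by (auto simp: power_le_one)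
  define P where "P = (s/2)\<^sup>2 * b + a"
  have "s\<^sup>2 * b \<le> b" using s nonneg by (intro mult_left_le_one_le) auto
  then have "P \<le> b + a" unfolding P_def using nonneg by (simp add: power_divide)
  then have P1: "P \<le> 1" using ab by simp
  have P0: "P > 0"
  proof (cases "a = 0")
    case True then show ?thesis using ab s by (simp add: P_def)
  next
    case False then show ?thesis using nonneg unfolding P_def by (intro add_nonneg_pos) auto
  qed
  have eq: "s\<^sup>2 * b + a = P + y" by (simp add: P_def y_def power_divide algebra_simps)
  have "s\<^sup>2 * b \<le> 1 * 1" using s nonneg ab by (intro mult_mono) auto
  moreover have "0 \<le> s\<^sup>2 * b" using nonneg by simp
  ultimately have y: "0 \<le> y" "y \<le> 3" unfolding y_def by linarith+
  have "P + y \<le> 4" using P1 y by simp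
  then have "y / 4 \<le> y / (P + y)" using P0 y by (intro divide_left_mono) auto
  also have "\<dots> = 1 - P / (P + y)" using P0 y by (simp add: field_simps)
  \<comment> \<open>Applying ln t <= t - 1 to the reciprocal ratio P / (P + y) yields the lower
    bound for the logarithm of (P + y) / P.\<close>
  also have "\<dots> \<le> - ln (P / (P + y))" using ln_le_minus_one[of "P / (P + y)"] P0 y by simp
  also have "\<dots> = ln (P + y) - ln P" using P0 y by (simp add: ln_div)
  finally show ?thesis unfolding sum eq P_def[symmetric] by (simp add: y_def b_def)
qed

lemma not_embeds_in_L0_infnorm:
  assumes card: "CARD('n::finite) \<ge> 4"
  shows "\<not> embeds_in_L0 (infnorm :: real ^ 'n \<Rightarrow> real)"
proof
  assume "embeds_in_L0 (infnorm :: real ^ 'n \<Rightarrow> real)"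
  then obtain \<mu> :: "(real ^ 'n) measure" and C where
    sets: "sets \<mu> = sets (restrict_space borel (sphere 0 1))" and fin: "finite_measure \<mu>"
    and nz: "\<And>x. x \<noteq> 0 \<Longrightarrow> AE \<xi> in \<mu>. x \<bullet> \<xi> \<noteq> 0"
    and rep: "\<And>x. x \<noteq> 0 \<Longrightarrow> ln (infnorm x) = (\<integral>\<xi>. ln \<bar>x \<bullet> \<xi>\<bar> \<partial>\<mu>) + C"
    unfolding embeds_in_L0_def by blast
  interpret \<mu>: finite_measure \<mu> by (rule fin)
  interpret G: prob_space "gauss_vec :: ('n \<Rightarrow> real) measure" by (rule prob_space_gauss_vec)
  note space = space_sphere_measure[OF sets] and nth [measurable] = borel_measurable_sphere_nth[OF sets]
  \<comment> \<open>Any coordinate serves, so an arbitrary one is fixed.\<close>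
  define k :: 'n where "k = undefined"
  define d where "d t i = (if i = k then t else 1)" for t :: real and i
  define S where "S t \<xi> = (\<Sum>i\<in>UNIV. (d t i * \<xi> $ i)\<^sup>2)" for t and \<xi> :: "real ^ 'n"
  define J where "J t z = (\<integral>\<xi>. ln \<bar>gauss_scale (d t) z \<bullet> \<xi>\<bar> \<partial>\<mu>)" for t z
  define G where "G = (\<integral>z. gauss_weight k z \<partial>gauss_vec)"
  define I where "I = (\<integral>\<xi>. (\<xi> $ k)\<^sup>2 \<partial>\<mu>)"
  have int_sq: "integrable \<mu> (\<lambda>\<xi>. (\<xi> $ k)\<^sup>2)"
  proof (rule \<mu>.integrable_const_bound[of _ 1])
    show "AE \<xi> in \<mu>. norm ((\<xi> $ k)\<^sup>2) \<le> 1"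
    proof (rule AE_I2)
      fix \<xi> assume "\<xi> \<in> space \<mu>"
      then have "\<bar>\<xi> $ k\<bar> \<le> 1" using component_le_norm_cart[of \<xi> k] by (simp add: space)
      then show "norm ((\<xi> $ k)\<^sup>2) \<le> 1" by (simp add: abs_square_le_1)
    qed
  qed measurable
  have all_nz: "AE z in gauss_vec. \<forall>i :: 'n. z i \<noteq> 0"
  proof -
    \<comment> \<open>A single coordinate is the linear form whose coefficients are the indicator of
      i.\<close>
    have "AE z in gauss_vec. z i \<noteq> 0" for i :: 'n
      using integral_gauss_vec_ln_inner(4)[of "\<lambda>j. if j = i then 1 else 0"]
      by (simp add: if_distrib[of "\<lambda>x. x\<^sup>2"] if_distrib[of "\<lambda>x. x * _"] cong: if_cong)
    then show ?thesis by (rule eventually_all_finite)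
  qed
  \<comment> \<open>The constant is half of 3/16, since the logarithm of the variance enters the
    averages with the factor 1/2.\<close>
  have key: "3 / 32 * s\<^sup>2 * I \<le> s powr (5/2) * G" if s: "0 < s" "s \<le> 1" for s
  proof -
    have d_pos: "d s i > 0" "d (s/2) i > 0" for i using s by (auto simp: d_def)
    note avg = gauss_average_ln_inner[OF sets fin, of "d s", folded S_def J_def]
      gauss_average_ln_inner[OF sets fin, of "d (s/2)", folded S_def J_def]
    have "3 / 32 * s\<^sup>2 * I = (\<integral>\<xi>. 3 / 32 * s\<^sup>2 * (\<xi> $ k)\<^sup>2 \<partial>\<mu>)" by (simp add: I_def)
    also have "\<dots> \<le> (\<integral>\<xi>. ln (S s \<xi>) / 2 - ln (S (s/2) \<xi>) / 2 \<partial>\<mu>)"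
    proof (rule integral_mono)
      fix \<xi> assume "\<xi> \<in> space \<mu>"
      then show "3 / 32 * s\<^sup>2 * (\<xi> $ k)\<^sup>2 \<le> ln (S s \<xi>) / 2 - ln (S (s/2) \<xi>) / 2"
        using sphere_quadratic_ln_diff[of \<xi> s k] s unfolding space S_def d_def by simp
    qed (use avg d_pos int_sq in auto)
    also have "\<dots> = (\<integral>\<xi>. ln (S s \<xi>) / 2 \<partial>\<mu>) - (\<integral>\<xi>. ln (S (s/2) \<xi>) / 2 \<partial>\<mu>)"
      using avg d_pos by (intro Bochner_Integration.integral_diff) auto
    \<comment> \<open>Both averages contain the same Gaussian constant times the mass of \<mu>,
      which cancels.\<close>
    also have "\<dots> = (\<integral>z. J s z \<partial>gauss_vec) - (\<integral>z. J (s/2) z \<partial>gauss_vec)"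
      using avg(2,5) d_pos by simp
    also have "\<dots> = (\<integral>z. J s z - J (s/2) z \<partial>gauss_vec)"
      using avg(1,4) d_pos by (intro Bochner_Integration.integral_diff[symmetric]) auto
    also have "\<dots> \<le> (\<integral>z. s powr (5/2) * gauss_weight k z \<partial>gauss_vec)"
    proof (rule integral_mono_AE)
      show "AE z in gauss_vec. J s z - J (s/2) z \<le> s powr (5/2) * gauss_weight k z"
        using all_nz
      proof eventually_elim
        case (elim z)
        \<comment> \<open>Both scaled vectors are nonzero, so the representation applies to each,
          and C cancels in the difference.\<close>
        have "gauss_scale (d t) z \<noteq> 0" if "t > 0" for t
          using elim that by (auto simp: gauss_scale_def d_def vec_eq_iff intro!: exI[of _ k])
        then have "ln (infnorm (gauss_scale (d s) z)) = J s z + C"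
          "ln (infnorm (gauss_scale (d (s/2)) z)) = J (s/2) z + C"
          using s unfolding J_def by (auto intro!: rep)
        moreover have "ln (infnorm (gauss_scale (d s) z)) - ln (infnorm (gauss_scale (d (s/2)) z))
            \<le> s powr (5/2) * gauss_weight k z"
          using ln_infnorm_diff_le[OF card, of z s k] elim s unfolding d_def by simp
        ultimately show ?case by simp
      qed
    qed (use avg d_pos integrable_gauss_weight[OF card] in auto)
    also have "\<dots> = s powr (5/2) * G" by (simp add: G_def)
    finally show ?thesis .
  qed
  have "I \<le> 0"
  proof (rule ccontr)
    assume "\<not> I \<le> 0"
    then have I: "I > 0" by simp
    \<comment> \<open>Dividing \<open>key\<close> by s^2 leaves (3/32) I <= s^(1/2) G, whose
      right-hand side tends to 0 as s decreases to 0.\<close>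
    have lim: "((\<lambda>s :: real. s powr (1/2)) \<longlongrightarrow> 0 powr (1/2)) (at_right 0)"
      by (rule tendsto_powr') (auto intro!: tendsto_intros simp: eventually_at_filter)
    then have "((\<lambda>s :: real. s powr (1/2) * G) \<longlongrightarrow> 0) (at_right 0)"
      using tendsto_mult_right[OF lim, of G] by simp
    moreover have "\<forall>\<^sub>F s in at_right 0. 3 / 32 * I \<le> s powr (1/2) * G"
    proof (rule eventually_at_rightI[of _ 1])
      fix s :: real assume "s \<in> {0<..<1}"
      then have s: "0 < s" "s \<le> 1" by auto
      have "s powr (5/2) = s powr (2 + 1/2)" by simp
      also have "\<dots> = s\<^sup>2 * s powr (1/2)" using s by (subst powr_add) simp
      finally have "s\<^sup>2 * (3 / 32 * I) \<le> s\<^sup>2 * (s powr (1/2) * G)" using key[OF s] by (simp add: mult_ac)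
      then show "3 / 32 * I \<le> s powr (1/2) * G" using s by simp
    qed simp
    ultimately have "3 / 32 * I \<le> 0"
      by (intro tendsto_lowerbound) auto
    then show False using I by simp
  qed
  then have "I = 0" by (simp add: I_def integral_nonneg_AE order_antisym)
  then have "AE \<xi> in \<mu>. (\<xi> $ k)\<^sup>2 = 0"
    unfolding I_def using int_sq by (subst (asm) integral_nonneg_eq_0_iff_AE) auto
  moreover have "AE \<xi> in \<mu>. axis k 1 \<bullet> \<xi> \<noteq> 0" by (rule nz) (simp add: axis_eq_0_iff)
  \<comment> \<open>The two almost sure statements contradict each other, so \<mu> is the null
    measure and all integrals against it vanish.\<close>
  ultimately have "AE \<xi> in \<mu>. False"
    by eventually_elim (simp add: inner_axis')
  then have "(\<integral>\<xi>. ln \<bar>x \<bullet> \<xi>\<bar> \<partial>\<mu>) = 0" for x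
    by (intro integral_eq_zero_AE) (auto elim: AE_mp)
  then have const: "ln (infnorm x) = C" if "x \<noteq> 0" for x :: "real ^ 'n"
    using rep[OF that] by simp
  \<comment> \<open>Doubling e adds ln 2 to the logarithm of its norm, which a constant value
    excludes.\<close>
  define e :: "real ^ 'n" where "e = axis k 1"
  have e: "e \<noteq> 0" by (simp add: e_def axis_eq_0_iff)
  then have "ln (infnorm (2 *\<^sub>R e)) = ln (infnorm e)" using const[of e] const[of "2 *\<^sub>R e"] by simp
  moreover have "ln (infnorm (2 *\<^sub>R e)) = ln 2 + ln (infnorm e)"
    using e by (simp add: infnorm_mul ln_mult infnorm_eq_0)
  ultimately show False by simp
qed

theorem theorem4p4:
  assumes "CARD('n::finite) \<ge> 4"
  shows "\<exists>K :: (real ^ 'n) set.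
           convex_body K \<and> origin_symmetric K \<and> \<not> embeds_in_L0 (minkowski_functional K)"
  using convex_body_cube origin_symmetric_cube not_embeds_in_L0_infnorm[OF assms]
  by (metis minkowski_functional_cube)

end
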